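(* Let $M(n)$ be the number of simply paired partitions of $n$ having negative pairing rank, and let $\overline p_{\mathrm{odd}}(n)$ be the number of overpartitions of $n$ into odd parts. Then, for every $n\geq 1$, $$M(n)=\frac12\,\overline p_{\mathrm{odd}}(n).$$
   Context: A partition is simply paired if no part occurs more than three times. For a partition $\lambda$, let $r(\lambda)$ be the largest part size of multiplicity at least $2$ ($r(\lambda)=0$ if $\lambda$ has distinct parts). Let $u_1>u_2>\cdots$ be the part sizes occurring with odd multiplicity, each taken once, and let $s(\lambda)=u_1-u_2+u_3-u_4+\cdots$ ($0$ if there are none). The pairing rank is $\rho(\lambda)=r(\lambda)-s(\lambda)$. An overpartition is a partition in which the first occurrence of each distinct part may be overlined. *)

theory Defs
  imports Complex_Main "HOL-Library.Multiset"
begin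

(* A partition is the finite multiset of its (positive) parts. *)
definition partition_of :: "nat \<Rightarrow> nat multiset \<Rightarrow> bool" where
  "partition_of n P \<longleftrightarrow> 0 \<notin># P \<and> sum_mset P = n"

definition simply_paired :: "nat multiset \<Rightarrow> bool" where
  "simply_paired P \<longleftrightarrow> (\<forall>k. count P k \<le> 3)"

definition repeated_parts :: "nat multiset \<Rightarrow> nat set" where
  "repeated_parts P = {k. count P k \<ge> 2}"

definition largest_repeated :: "nat multiset \<Rightarrow> nat" where
  "largest_repeated P = (if repeated_parts P = {} then 0 else Max (repeated_parts P))"

definition odd_mult_parts :: "nat multiset \<Rightarrow> nat list" where
  "odd_mult_parts P = rev (sorted_list_of_set {k. odd (count P k)})"

(* List indices start at 0, so the largest part gets sign +1. *)
definition alternating_sum :: "nat list \<Rightarrow> int" where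
  "alternating_sum us = (\<Sum>i<length us. (- 1) ^ i * int (us ! i))"

definition pairing_rank :: "nat multiset \<Rightarrow> int" where
  "pairing_rank P = int (largest_repeated P) - alternating_sum (odd_mult_parts P)"

definition num_negative_rank :: "nat \<Rightarrow> nat" where
  "num_negative_rank n = card {P. partition_of n P \<and> simply_paired P \<and> pairing_rank P < 0}"

(* The second component is the set of part sizes whose first occurrence is overlined. *)
definition overpartition_of :: "nat \<Rightarrow> nat multiset \<times> nat set \<Rightarrow> bool" where
  "overpartition_of n X \<longleftrightarrow> partition_of n (fst X) \<and> snd X \<subseteq> set_mset (fst X)"

definition num_odd_overpartitions :: "nat \<Rightarrow> nat" where
  "num_odd_overpartitions n =
     card {X. overpartition_of n X \<and> (\<forall>k \<in># fst X. odd k)}"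

(* Finiteness, so that card is a genuine count in the definitions above. *)
lemma size_le_sum_mset: "0 \<notin># (P :: nat multiset) \<Longrightarrow> size P \<le> sum_mset P"
  by (induction P) (auto simp: Suc_le_eq)

lemma finite_partitions: "finite {P. partition_of n P}"
proof (rule finite_subset)
  show "{P. partition_of n P} \<subseteq> mset ` {xs. set xs \<subseteq> {..n} \<and> length xs \<le> n}"
  proof
    fix P assume "P \<in> {P. partition_of n P}"
    then have P: "0 \<notin># P" "sum_mset P = n"
      by (auto simp: partition_of_def)
    obtain xs where xs: "mset xs = P"
      using ex_mset by blast
    have "k \<le> n" if "k \<in># P" for k
      using P(2) multi_member_split[OF that] by auto
    moreover have "size P \<le> n"
      using size_le_sum_mset[OF P(1)] P(2) by simp
    ultimately show "P \<in> mset ` {xs. set xs \<subseteq> {..n} \<and> length xs \<le> n}"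
      using xs by (intro image_eqI[of _ _ xs]) auto
  qed
  show "finite (mset ` {xs. set xs \<subseteq> {..n} \<and> length xs \<le> n})"
    by (intro finite_imageI finite_lists_length_le) simp
qed

lemma finite_overpartitions: "finite {X. overpartition_of n X}"
proof -
  have "{X. overpartition_of n X} = Sigma {P. partition_of n P} (\<lambda>P. Pow (set_mset P))"
    by (auto simp: overpartition_of_def)
  then show ?thesis
    by (simp add: finite_partitions)
qed

end

theory Submission
  imports Defs "HOL-Computational_Algebra.Formal_Power_Series"
begin

text \<open>
  A simply paired partition is a pair \<open>(S, D)\<close> of finite sets of positive integers, the parts of odd
  multiplicity and the repeated parts, of weight \<open>\<Sum>S + 2 * \<Sum>D\<close>. Its pairing rank is negative iff
  the alternating sum \<open>m\<close> of \<open>S\<close> is positive and \<open>D \<subseteq> {1..<m}\<close>. Inserting \<open>N + 1\<close> into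
  \<open>S \<subseteq> {1..N}\<close> turns the alternating sum \<open>m\<close> into \<open>N + 1 - m\<close>; this is the Pascal rule for
  Gaussian binomials in base \<open>X\<^sup>2\<close>, so the sets \<open>S \<subseteq> {1..N}\<close> of alternating sum \<open>m\<close> are
  counted by \<open>X\<^sup>m [N choose m]\<close>. Letting \<open>N\<close> grow, the other Pascal rule gives
  \<open>(1 - X\<^bsup>2m+2\<^esup>) C\<^bsub>m+1\<^esub> = X C\<^sub>m\<close> for the series \<open>C\<^sub>m\<close> of all \<open>S\<close> of alternating sum \<open>m\<close>.
  With the sets \<open>D\<close> included, this becomes the recurrence
  \<open>(1 - X\<^bsup>2m+2\<^esup>) A\<^bsub>m+1\<^esub> = X (1 + X\<^bsup>2m\<^esup>) A\<^sub>m\<close>, which overpartitions into \<open>m\<close> odd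
  parts satisfy as well; at \<open>m = 1\<close> the latter are twice as many.
\<close>

unbundle fps_syntax

section \<open>Weight generating functions\<close>

text \<open>A coefficient is a genuine count only where the fibre is finite, since
  \<open>card\<close> is 0 on infinite sets. Integer coefficients make room for the factors
  \<open>1 - fps_X ^ k\<close>.\<close>

definition weight_fps :: "('a \<Rightarrow> nat) \<Rightarrow> 'a set \<Rightarrow> int fps" where
  "weight_fps w T = Abs_fps (\<lambda>n. int (card {t \<in> T. w t = n}))"

lemma weight_fps_nth: "weight_fps w T $ n = int (card {t \<in> T. w t = n})"
  by (simp add: weight_fps_def)

lemma weight_fps_empty [simp]: "weight_fps w {} = 0"
  by (rule fps_ext) (simp add: weight_fps_nth)

lemma weight_fps_singleton [simp]: "weight_fps w {t} = fps_X ^ w t"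
proof (rule fps_ext)
  fix n
  have "{s \<in> {t}. w s = n} = (if w t = n then {t} else {})"
    by auto
  then show "weight_fps w {t} $ n = (fps_X ^ w t) $ n"
    by (simp add: weight_fps_nth fps_X_power_nth)
qed

lemma weight_fps_image:
  assumes inj: "inj_on f T" and w: "\<And>t. t \<in> T \<Longrightarrow> w' (f t) = w t + k"
  shows "weight_fps w' (f ` T) = fps_X ^ k * weight_fps w T"
proof (rule fps_ext)
  fix n
  show "weight_fps w' (f ` T) $ n = (fps_X ^ k * weight_fps w T) $ n"
  proof (cases "n < k")
    case True
    then have "{t \<in> f ` T. w' t = n} = {}"
      using w by auto
    then show ?thesis
      using True unfolding weight_fps_nth fps_X_power_mult_nth by (simp only: card.empty) simp
  next
    case False
    then have "{t \<in> f ` T. w' t = n} = f ` {t \<in> T. w t = n - k}"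
      using w by auto
    moreover have "inj_on f {t \<in> T. w t = n - k}"
      using inj by (rule inj_on_subset) auto
    ultimately show ?thesis
      using False by (simp add: weight_fps_nth fps_X_power_mult_nth card_image)
  qed
qed

lemma weight_fps_Un:
  assumes "\<And>n. finite {t \<in> A. w t = n}" "\<And>n. finite {t \<in> B. w t = n}" "A \<inter> B = {}"
  shows "weight_fps w (A \<union> B) = weight_fps w A + weight_fps w B"
proof (rule fps_ext)
  fix n
  have "{t \<in> A \<union> B. w t = n} = {t \<in> A. w t = n} \<union> {t \<in> B. w t = n}"
    by auto
  moreover have "{t \<in> A. w t = n} \<inter> {t \<in> B. w t = n} = {}"
    using assms(3) by auto
  ultimately show "weight_fps w (A \<union> B) $ n = (weight_fps w A + weight_fps w B) $ n"
    by (simp add: weight_fps_nth card_Un_disjoint assms(1,2))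
qed

lemma weight_fps_Times:
  assumes "\<And>n. finite {a \<in> A. v a = n}" "\<And>n. finite {b \<in> B. w b = n}"
  shows "weight_fps (\<lambda>(a, b). v a + w b) (A \<times> B) = weight_fps v A * weight_fps w B"
proof (rule fps_ext)
  fix n
  have "{t \<in> A \<times> B. (case t of (a, b) \<Rightarrow> v a + w b) = n}
      = (\<Union>i\<in>{0..n}. {a \<in> A. v a = i} \<times> {b \<in> B. w b = n - i})"
    by auto
  moreover have "card \<dots> = (\<Sum>i = 0..n. card ({a \<in> A. v a = i} \<times> {b \<in> B. w b = n - i}))"
    using assms by (intro card_UN_disjoint) auto
  ultimately show "weight_fps (\<lambda>(a, b). v a + w b) (A \<times> B) $ n
      = (weight_fps v A * weight_fps w B) $ n"
    by (simp add: weight_fps_nth fps_mult_nth card_cartesian_product)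
qed

text \<open>Applied to a class that splits into a shifted copy of itself, \<open>b * a\<close>, and
  a remainder \<open>c\<close>.\<close>

lemma one_minus_mult_eqI:
  fixes a b c :: "'a::comm_ring_1"
  assumes "a = b * a + c"
  shows "(1 - b) * a = c"
proof -
  have "(1 - b) * a = a - b * a"
    by (simp add: algebra_simps)
  also have "\<dots> = c"
    using assms by (metis add_diff_cancel_left')
  finally show ?thesis .
qed

section \<open>Gaussian binomial coefficients\<close>

text \<open>Defined by a Pascal rule instead of a quotient, so that it makes sense in every
  commutative ring. Where the exponent \<open>N - m\<close> is truncated, its factor
  \<open>qbinom q N m\<close> is 0.\<close>

fun qbinom :: "'a::comm_ring_1 \<Rightarrow> nat \<Rightarrow> nat \<Rightarrow> 'a" where
  "qbinom q N 0 = 1"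
| "qbinom q 0 (Suc m) = 0"
| "qbinom q (Suc N) (Suc m) = qbinom q N (Suc m) + q ^ (N - m) * qbinom q N m"

lemma qbinom_eq_0: "N < m \<Longrightarrow> qbinom q N m = 0"
  by (induction q N m rule: qbinom.induct) auto

lemma qbinom_self: "qbinom q N N = 1"
  by (induction N) (auto simp: qbinom_eq_0)

text \<open>Expand by the defining rule, apply the induction hypothesis to both summands and regroup
  by the defining rule. Unlike there, the exponent here is free of \<open>N\<close>, so this rule
  survives letting \<open>N\<close> grow.\<close>

lemma qbinom_Suc_Suc_dual:
  "qbinom q (Suc N) (Suc m) = q ^ Suc m * qbinom q N (Suc m) + qbinom q N m"
proof (induction N arbitrary: m)
  case 0
  then show ?case by (cases m) auto
next
  case (Suc N)
  show ?case
  proof (cases m)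
    case 0
    have "qbinom q (Suc (Suc N)) (Suc 0) = qbinom q (Suc N) (Suc 0) + q * q ^ N"
      by simp
    also have "\<dots> = q * (qbinom q N (Suc 0) + q ^ N) + 1"
      by (simp only: Suc.IH) (simp add: distrib_left)
    finally show ?thesis
      by (simp add: 0)
  next
    case m: (Suc k)
    \<comment> \<open>The exponents on both sides agree when \<open>m \<le> N\<close>; otherwise
      both sides are 0.\<close>
    have pow: "q ^ (Suc N - m) * (q ^ m * qbinom q N m)
        = q ^ Suc m * (q ^ (N - m) * qbinom q N m)"
    proof (cases "m \<le> N")
      case True
      then have "Suc N - m + m = Suc m + (N - m)"
        by simp
      then show ?thesis
        by (simp only: mult.assoc[symmetric] power_add[symmetric])
    qed (simp add: qbinom_eq_0)
    have "qbinom q (Suc (Suc N)) (Suc m)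
        = qbinom q (Suc N) (Suc m) + q ^ (Suc N - m) * qbinom q (Suc N) m"
      by simp
    also have "\<dots> = q ^ Suc m * qbinom q N (Suc m) + qbinom q N m
        + q ^ (Suc N - m) * (q ^ m * qbinom q N m + qbinom q N k)"
      by (simp only: Suc.IH m)
    also have "\<dots> = q ^ Suc m * (qbinom q N (Suc m) + q ^ (N - m) * qbinom q N m)
        + (qbinom q N m + q ^ (N - k) * qbinom q N k)"
      using pow m by (simp add: distrib_left)
    also have "\<dots> = q ^ Suc m * qbinom q (Suc N) (Suc m) + qbinom q (Suc N) m"
      by (simp add: m)
    finally show ?thesis .
  qed
qed

text \<open>Reflecting the lower index exchanges the two Pascal rules: the left side is expanded by
  the dual rule, the right side by the defining one.\<close>

lemma qbinom_symmetric: "m \<le> N \<Longrightarrow> qbinom q N (N - m) = qbinom q N m"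
proof (induction N arbitrary: m)
  case (Suc N)
  show ?case
  proof (cases m)
    case 0
    then show ?thesis by (simp add: qbinom_self del: qbinom.simps(3))
  next
    case m: (Suc k)
    show ?thesis
    proof (cases "k = N")
      case True
      then show ?thesis using m by (simp add: qbinom_self del: qbinom.simps(3))
    next
      case False
      with m Suc.prems have k: "k < N" by simp
      then have sub: "Suc N - m = Suc (N - Suc k)" "Suc (N - Suc k) = N - k"
        using m by auto
      have "qbinom q (Suc N) (Suc N - m)
          = q ^ (N - k) * qbinom q N (N - k) + qbinom q N (N - Suc k)"
        unfolding sub(1) qbinom_Suc_Suc_dual by (simp only: sub(2))
      also have "\<dots> = qbinom q (Suc N) m"
        using Suc.IH[of k] Suc.IH[of "Suc k"] k m by simp
      finally show ?thesis .
    qed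
  qed
qed simp

section \<open>Strict partitions by alternating sum\<close>

definition alt_sum :: "nat set \<Rightarrow> int" where
  "alt_sum S = alternating_sum (rev (sorted_list_of_set S))"

lemma alternating_sum_Cons: "alternating_sum (u # us) = int u - alternating_sum us"
  unfolding alternating_sum_def
  by (simp add: sum.lessThan_Suc_shift sum_negf[symmetric] del: sum.lessThan_Suc)

lemma alt_sum_empty [simp]: "alt_sum {} = 0"
  by (simp add: alt_sum_def alternating_sum_def)

text \<open>\<open>Suc N\<close> exceeds all of \<open>S\<close>, so it heads the decreasing list
  and flips every other sign.\<close>

lemma alt_sum_insert_Suc:
  assumes "S \<subseteq> {1..N}"
  shows "alt_sum (insert (Suc N) S) = int (Suc N) - alt_sum S"
proof -
  have fin: "finite S" and "Suc N \<notin> S"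
    using assms finite_subset by auto
  then have "sorted_list_of_set (insert (Suc N) S) = insort (Suc N) (sorted_list_of_set S)"
    by simp
  also have "\<dots> = sorted_list_of_set S @ [Suc N]"
    using fin assms by (intro sorted_insort_is_snoc) auto
  finally show ?thesis
    by (simp add: alt_sum_def alternating_sum_Cons)
qed

lemma Pow_atLeastAtMost_Suc:
  "Pow {1..Suc N} = Pow {1..N} \<union> insert (Suc N) ` Pow {1..N}"
  by (simp add: atLeastAtMostSuc_conv Pow_insert)

lemma alt_sum_bounds: "S \<subseteq> {1..N} \<Longrightarrow> 0 \<le> alt_sum S \<and> alt_sum S \<le> int N"
proof (induction N arbitrary: S)
  case (Suc N)
  then have "S \<in> Pow {1..N} \<union> insert (Suc N) ` Pow {1..N}"
    using Pow_atLeastAtMost_Suc by blast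
  then show ?case
  proof
    assume "S \<in> Pow {1..N}"
    then show ?thesis using Suc.IH[of S] by simp
  next
    assume "S \<in> insert (Suc N) ` Pow {1..N}"
    then obtain T where T: "T \<subseteq> {1..N}" "S = insert (Suc N) T" by auto
    then show ?thesis
      using Suc.IH[OF T(1)] alt_sum_insert_Suc[OF T(1)] by simp
  qed
qed simp

definition bounded_alt :: "nat \<Rightarrow> nat \<Rightarrow> nat set set" where
  "bounded_alt N m = {S. S \<subseteq> {1..N} \<and> alt_sum S = int m}"

text \<open>Finiteness is explicit because \<open>alt_sum\<close> takes the default value 0 on
  infinite sets.\<close>

definition strict_alt :: "nat \<Rightarrow> nat set set" where
  "strict_alt m = {S. finite S \<and> 0 \<notin> S \<and> alt_sum S = int m}"

lemma finite_bounded_alt: "finite (bounded_alt N m)"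
  by (rule finite_subset[of _ "Pow {1..N}"]) (auto simp: bounded_alt_def)

lemma bounded_alt_le: "S \<in> bounded_alt N m \<Longrightarrow> m \<le> N"
  using alt_sum_bounds[of S N] by (simp add: bounded_alt_def)

lemma bounded_alt_eq_empty: "N < m \<Longrightarrow> bounded_alt N m = {}"
  using bounded_alt_le by (meson equals0I not_le)

text \<open>Split by whether \<open>Suc N\<close> is an element; if it is, the remaining set has the
  reflected alternating sum. The bound on \<open>m\<close> makes the natural subtraction
  exact.\<close>

lemma bounded_alt_Suc:
  assumes "m \<le> Suc N"
  shows "bounded_alt (Suc N) m = bounded_alt N m \<union> insert (Suc N) ` bounded_alt N (Suc N - m)"
proof -
  have "bounded_alt (Suc N) m = {S \<in> Pow {1..Suc N}. alt_sum S = int m}"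
    by (auto simp: bounded_alt_def)
  also have "\<dots> = {S \<in> Pow {1..N}. alt_sum S = int m}
      \<union> {S \<in> insert (Suc N) ` Pow {1..N}. alt_sum S = int m}"
    unfolding Pow_atLeastAtMost_Suc by auto
  also have "{S \<in> insert (Suc N) ` Pow {1..N}. alt_sum S = int m}
      = insert (Suc N) ` {S \<in> Pow {1..N}. alt_sum (insert (Suc N) S) = int m}"
    by auto
  also have "{S \<in> Pow {1..N}. alt_sum (insert (Suc N) S) = int m}
      = {S \<in> Pow {1..N}. alt_sum S = int (Suc N - m)}"
  proof (rule Collect_cong, rule conj_cong[OF refl])
    fix S assume "S \<in> Pow {1..N}"
    then have "alt_sum (insert (Suc N) S) = int (Suc N) - alt_sum S"
      by (intro alt_sum_insert_Suc) simp
    moreover have "int (Suc N - m) = int (Suc N) - int m"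
      using assms by (rule of_nat_diff)
    ultimately show "alt_sum (insert (Suc N) S) = int m \<longleftrightarrow> alt_sum S = int (Suc N - m)"
      by linarith
  qed
  finally show ?thesis
    by (simp add: bounded_alt_def)
qed

lemma weight_fps_bounded_alt:
  "weight_fps (\<lambda>S. \<Sum>S) (bounded_alt N m) = fps_X ^ m * qbinom (fps_X ^ 2) N m"
proof (induction N arbitrary: m)
  case 0
  show ?case
  proof (cases m)
    case 0
    have "bounded_alt 0 0 = {{}}"
      by (auto simp: bounded_alt_def)
    then show ?thesis by (simp add: 0)
  qed (simp add: bounded_alt_eq_empty)
next
  case (Suc N)
  show ?case
  proof (cases "m \<le> Suc N")
    case False
    then show ?thesis
      by (simp add: bounded_alt_eq_empty qbinom_eq_0 del: qbinom.simps)
  next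
    case True
    let ?w = "\<lambda>S::nat set. \<Sum>S"
    let ?B = "bounded_alt N (Suc N - m)"
    have sub: "S \<subseteq> {1..N}" if "S \<in> bounded_alt N k" for S k
      using that by (simp add: bounded_alt_def)
    have notin: "Suc N \<notin> S" if "S \<in> bounded_alt N k" for S k
      using sub[OF that] by auto
    have "inj_on (insert (Suc N)) ?B"
      by (rule inj_onI) (simp add: notin insert_ident)
    moreover have "?w (insert (Suc N) S) = ?w S + Suc N" if "S \<in> ?B" for S
    proof -
      have "finite S"
        using sub[OF that] by (rule finite_subset) simp
      then show ?thesis using notin[OF that] by simp
    qed
    ultimately have image: "weight_fps ?w (insert (Suc N) ` ?B) = fps_X ^ Suc N * weight_fps ?w ?B"
      by (rule weight_fps_image)
    have "weight_fps ?w (bounded_alt (Suc N) m)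
        = weight_fps ?w (bounded_alt N m) + weight_fps ?w (insert (Suc N) ` ?B)"
      unfolding bounded_alt_Suc[OF True]
    proof (rule weight_fps_Un)
      show "bounded_alt N m \<inter> insert (Suc N) ` ?B = {}"
        using notin[of _ m] by blast
    qed (simp_all add: finite_bounded_alt)
    also have "\<dots> = fps_X ^ m * qbinom (fps_X ^ 2) N m
        + fps_X ^ Suc N * (fps_X ^ (Suc N - m) * qbinom (fps_X ^ 2) N (Suc N - m))"
      by (simp only: image Suc.IH)
    also have "\<dots> = fps_X ^ m * qbinom (fps_X ^ 2) (Suc N) m"
    proof (cases m)
      \<comment> \<open>The reflected index is \<open>Suc N\<close>, beyond the range of
        \<open>qbinom _ N\<close>, so the second summand vanishes.\<close>
      case 0
      then show ?thesis by (simp add: qbinom_eq_0)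
    next
      case m: (Suc k)
      have sym: "qbinom (fps_X ^ 2 :: int fps) N (N - k) = qbinom (fps_X ^ 2) N k"
        using True m by (intro qbinom_symmetric) simp
      \<comment> \<open>The inserted element contributes \<open>Suc N\<close> and the reflected sum
        \<open>N - k\<close>. Together they give the prefactor exponent \<open>Suc k\<close> and
        twice the Pascal exponent \<open>N - k\<close>, which explains the base
        \<open>fps_X ^ 2\<close>.\<close>
      have "Suc N + (N - k) = Suc k + 2 * (N - k)"
        using True m by simp
      then have "(fps_X :: int fps) ^ Suc N * fps_X ^ (N - k)
          = fps_X ^ Suc k * (fps_X ^ 2) ^ (N - k)"
        by (simp only: power_add[symmetric] power_mult[symmetric])
      then show ?thesis
        unfolding m diff_Suc_Suc sym qbinom.simps distrib_left mult.assoc[symmetric]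
        by (simp only:)
    qed
    finally show ?thesis .
  qed
qed

text \<open>No element exceeds the total, so for the coefficients up to \<open>N\<close> the
  truncation to \<open>{1..N}\<close> loses nothing.\<close>

lemma strict_alt_sub_bounded:
  assumes "S \<in> strict_alt m" "\<Sum>S \<le> N"
  shows "S \<in> bounded_alt N m"
proof -
  have "k \<in> {1..N}" if k: "k \<in> S" for k
  proof -
    have "finite S" "0 \<notin> S"
      using assms(1) by (simp_all add: strict_alt_def)
    then have "k \<noteq> 0" "k \<le> \<Sum>S"
      using k member_le_sum[of k S "\<lambda>x. x"] by (metis, simp)
    then show ?thesis
      using assms(2) by simp
  qed
  then show ?thesis
    using assms(1) unfolding strict_alt_def bounded_alt_def by blast
qed

lemma bounded_alt_sub_strict: "bounded_alt N m \<subseteq> strict_alt m"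
proof
  fix S assume S: "S \<in> bounded_alt N m"
  then have "S \<subseteq> {1..N}"
    by (simp add: bounded_alt_def)
  then have "finite S" "0 \<notin> S"
    using finite_subset[of S "{1..N}"] by auto
  then show "S \<in> strict_alt m"
    using S by (simp add: strict_alt_def bounded_alt_def)
qed

lemma strict_alt_fibre:
  assumes "n \<le> N"
  shows "{S \<in> strict_alt m. \<Sum>S = n} = {S \<in> bounded_alt N m. \<Sum>S = n}"
  using strict_alt_sub_bounded bounded_alt_sub_strict assms by blast

lemma finite_strict_alt_fibre: "finite {S \<in> strict_alt m. \<Sum>S = n}"
  unfolding strict_alt_fibre[OF order_refl] by (simp add: finite_bounded_alt)

lemma weight_fps_strict_alt_nth:
  assumes "n \<le> N"
  shows "weight_fps (\<lambda>S. \<Sum>S) (strict_alt m) $ n = weight_fps (\<lambda>S. \<Sum>S) (bounded_alt N m) $ n"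
  unfolding weight_fps_nth strict_alt_fibre[OF assms] ..

lemma weight_fps_strict_alt_0: "weight_fps (\<lambda>S. \<Sum>S) (strict_alt 0) = 1"
  by (rule fps_ext)
    (simp only: weight_fps_strict_alt_nth[OF order_refl] weight_fps_bounded_alt qbinom.simps power_0 mult_1)

lemma weight_fps_strict_alt_Suc:
  "(1 - fps_X ^ (2 * Suc m)) * weight_fps (\<lambda>S. \<Sum>S) (strict_alt (Suc m))
    = fps_X * weight_fps (\<lambda>S. \<Sum>S) (strict_alt m)"
proof -
  let ?b = "\<lambda>N m. weight_fps (\<lambda>S. \<Sum>S) (bounded_alt N m)"
  let ?c = "\<lambda>m. weight_fps (\<lambda>S. \<Sum>S) (strict_alt m)"
  have rec: "?b (Suc N) (Suc m) = fps_X ^ (2 * Suc m) * ?b N (Suc m) + fps_X ^ 1 * ?b N m" for N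
    unfolding weight_fps_bounded_alt qbinom_Suc_Suc_dual power_mult
    by (simp add: algebra_simps)
  have "?c (Suc m) = fps_X ^ (2 * Suc m) * ?c (Suc m) + fps_X ^ 1 * ?c m"
  proof (rule fps_ext)
    fix n
    \<comment> \<open>The truncation starts at \<open>Suc n\<close> because \<open>rec\<close>
      lowers it by one; \<open>n\<close> is still large enough for the shifted coefficients on the
      right, whose indices are at most \<open>n\<close>.\<close>
    have "?c (Suc m) $ n = ?b (Suc n) (Suc m) $ n"
      by (rule weight_fps_strict_alt_nth) simp
    also have "\<dots> = (fps_X ^ (2 * Suc m) * ?c (Suc m) + fps_X ^ 1 * ?c m) $ n"
      unfolding rec fps_add_nth fps_X_power_mult_nth
      by (simp only: weight_fps_strict_alt_nth[OF diff_le_self])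
    finally show "?c (Suc m) $ n = (fps_X ^ (2 * Suc m) * ?c (Suc m) + fps_X ^ 1 * ?c m) $ n" .
  qed
  then show ?thesis
    unfolding power_one_right by (rule one_minus_mult_eqI)
qed

section \<open>Simply paired partitions of negative pairing rank\<close>

definition rank_pairs :: "nat \<Rightarrow> (nat set \<times> nat set) set" where
  "rank_pairs m = strict_alt m \<times> Pow {1..<m}"

definition pair_weight :: "nat set \<times> nat set \<Rightarrow> nat" where
  "pair_weight = (\<lambda>(S, D). \<Sum>S + 2 * \<Sum>D)"

text \<open>Multiplicities 0 to 3 in binary: \<open>S\<close> carries the units digit,
  \<open>D\<close> the twos digit.\<close>

definition pair_mset :: "nat set \<times> nat set \<Rightarrow> nat multiset" where
  "pair_mset = (\<lambda>(S, D). mset_set S + mset_set D + mset_set D)"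

lemma weight_fps_Pow_Suc:
  assumes "m \<ge> 1"
  shows "weight_fps (\<lambda>D. 2 * \<Sum>D) (Pow {1..<Suc m})
    = (1 + fps_X ^ (2 * m)) * weight_fps (\<lambda>D. 2 * \<Sum>D) (Pow {1..<m})"
proof -
  let ?w = "\<lambda>D::nat set. 2 * \<Sum>D"
  have "Pow {1..<Suc m} = Pow {1..<m} \<union> insert m ` Pow {1..<m}"
    using assms by (simp add: atLeastLessThanSuc Pow_insert)
  then have "weight_fps ?w (Pow {1..<Suc m})
      = weight_fps ?w (Pow {1..<m}) + weight_fps ?w (insert m ` Pow {1..<m})"
    by (simp only:) (rule weight_fps_Un; auto)
  also have "weight_fps ?w (insert m ` Pow {1..<m}) = fps_X ^ (2 * m) * weight_fps ?w (Pow {1..<m})"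
  proof (rule weight_fps_image)
    show "inj_on (insert m) (Pow {1..<m})"
      by (intro inj_onI) (metis PowD atLeastLessThan_iff insert_ident less_irrefl subsetD)
    fix D assume "D \<in> Pow {1..<m}"
    then have "finite D" "m \<notin> D"
      using finite_subset by auto
    then show "?w (insert m D) = ?w D + 2 * m" by simp
  qed
  finally show ?thesis
    by (simp add: algebra_simps)
qed

lemma weight_fps_rank_pairs:
  "weight_fps pair_weight (rank_pairs m)
    = weight_fps (\<lambda>S. \<Sum>S) (strict_alt m) * weight_fps (\<lambda>D. 2 * \<Sum>D) (Pow {1..<m})"
  unfolding pair_weight_def rank_pairs_def
  by (rule weight_fps_Times) (simp_all add: finite_strict_alt_fibre)

text \<open>At \<open>m = 1\<close> no part may be repeated, so the step from 0 to 1 brings no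
  factor \<open>1 + fps_X ^ 0 = 2\<close>. For overpartitions it does, and this is the source of the
  factor 2 in the theorem.\<close>

lemma weight_fps_rank_pairs_1:
  "(1 - fps_X ^ 2) * weight_fps pair_weight (rank_pairs 1) = fps_X"
  using weight_fps_strict_alt_Suc[of 0]
  by (simp add: weight_fps_rank_pairs weight_fps_strict_alt_0)

lemma weight_fps_rank_pairs_Suc:
  assumes "m \<ge> 1"
  shows "(1 - fps_X ^ (2 * Suc m)) * weight_fps pair_weight (rank_pairs (Suc m))
    = fps_X * (1 + fps_X ^ (2 * m)) * weight_fps pair_weight (rank_pairs m)"
  unfolding weight_fps_rank_pairs weight_fps_Pow_Suc[OF assms] mult.assoc[symmetric]
    weight_fps_strict_alt_Suc
  by (simp only: mult_ac)

section \<open>Correspondence between pairs of sets and simply paired partitions\<close>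

lemma count_pair_mset:
  "finite S \<Longrightarrow> finite D \<Longrightarrow>
    count (pair_mset (S, D)) k = (if k \<in> S then 1 else 0) + (if k \<in> D then 2 else 0)"
  by (simp add: pair_mset_def count_mset_set')

lemma pair_mset_inverse:
  assumes "finite S" "finite D"
  shows "{k. odd (count (pair_mset (S, D)) k)} = S" "repeated_parts (pair_mset (S, D)) = D"
  using assms by (auto simp: count_pair_mset repeated_parts_def)

text \<open>A multiplicity of at most 3 is determined by its parity and by whether it is at least
  2.\<close>

lemma pair_mset_odd_repeated:
  assumes "simply_paired P"
  shows "pair_mset ({k. odd (count P k)}, repeated_parts P) = P"
proof (rule multiset_eqI)
  fix k
  have "{k. odd (count P k)} \<subseteq> set_mset P" "repeated_parts P \<subseteq> set_mset P"
    by (auto simp: repeated_parts_def elim: oddE simp flip: count_greater_zero_iff)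
  then have fin: "finite {k. odd (count P k)}" "finite (repeated_parts P)"
    using finite_subset by blast+
  have "count P k \<in> {0, 1, 2, 3}"
    using assms unfolding simply_paired_def by (metis insertCI le_SucE le_zero_eq numeral_3_eq_3 One_nat_def numeral_2_eq_2)
  then show "count (pair_mset ({k. odd (count P k)}, repeated_parts P)) k = count P k"
    unfolding count_pair_mset[OF fin] by (auto simp: repeated_parts_def)
qed

lemma pairing_rank_pair_mset:
  assumes "finite S" "finite D"
  shows "pairing_rank (pair_mset (S, D)) = int (if D = {} then 0 else Max D) - alt_sum S"
  by (simp add: pairing_rank_def largest_repeated_def odd_mult_parts_def alt_sum_def
      pair_mset_inverse[OF assms])

lemma sum_mset_pair_mset: "finite S \<Longrightarrow> finite D \<Longrightarrow> sum_mset (pair_mset (S, D)) = pair_weight (S, D)"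
  by (simp add: pair_mset_def pair_weight_def sum_unfold_sum_mset)

lemma rank_pairs_D:
  "(S, D) \<in> rank_pairs m \<Longrightarrow> finite S \<and> finite D \<and> alt_sum S = int m"
  using finite_subset by (auto simp: rank_pairs_def strict_alt_def)

text \<open>Here \<open>m\<close> is the alternating sum of \<open>S\<close>, and negative rank says
  that all of \<open>D\<close> lies below it. Confining \<open>m\<close> to \<open>{1..n}\<close>
  makes the later sum over \<open>m\<close> finite.\<close>

lemma negative_rank_pair_mset_iff:
  assumes "finite S" "finite D"
  shows "partition_of n (pair_mset (S, D)) \<and> simply_paired (pair_mset (S, D))
      \<and> pairing_rank (pair_mset (S, D)) < 0
    \<longleftrightarrow> (\<exists>m\<in>{1..n}. (S, D) \<in> rank_pairs m \<and> pair_weight (S, D) = n)" (is "?L \<longleftrightarrow> ?R")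
proof
  assume L: ?L
  then have w: "pair_weight (S, D) = n"
    by (simp add: partition_of_def sum_mset_pair_mset[OF assms])
  have zero: "0 \<notin> S" "0 \<notin> D"
    using L assms by (auto simp: partition_of_def pair_mset_def)
  have alt: "int (if D = {} then 0 else Max D) < alt_sum S"
    using L by (simp add: pairing_rank_pair_mset[OF assms])
  \<comment> \<open>The largest repeated part, 0 by default, is nonnegative, so the alternating sum
    is positive.\<close>
  then obtain m where m: "alt_sum S = int m" "m \<ge> 1"
    by (metis of_nat_0_le_iff order_le_less_trans pos_int_cases Suc_leI One_nat_def)
  have "D \<subseteq> {1..<m}"
  proof
    fix k assume k: "k \<in> D"
    then have "k \<le> Max D" "D \<noteq> {}"
      using assms by auto
    moreover have "k \<noteq> 0"
      using k zero(2) by metis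
    ultimately show "k \<in> {1..<m}"
      using alt m by simp
  qed
  then have mem: "(S, D) \<in> rank_pairs m"
    using assms zero m by (simp add: rank_pairs_def strict_alt_def)
  \<comment> \<open>The elements of \<open>S\<close> are thus at most \<open>n\<close>, and the
    alternating sum cannot exceed a bound on the elements.\<close>
  have "\<Sum>S \<le> n"
    using w by (simp add: pair_weight_def)
  then have "S \<in> bounded_alt n m"
    using mem by (intro strict_alt_sub_bounded) (auto simp: rank_pairs_def)
  then have "m \<le> n"
    by (rule bounded_alt_le)
  then show ?R
    using mem w m by auto
next
  assume ?R
  then obtain m where m: "m \<ge> 1" "S \<in> strict_alt m" "D \<subseteq> {1..<m}" "pair_weight (S, D) = n"
    by (auto simp: rank_pairs_def)
  have "partition_of n (pair_mset (S, D))"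
    using m assms
    by (auto simp: partition_of_def sum_mset_pair_mset) (auto simp: pair_mset_def strict_alt_def)
  moreover have "simply_paired (pair_mset (S, D))"
    by (simp add: simply_paired_def count_pair_mset[OF assms])
  moreover have "(if D = {} then 0 else Max D) < m"
    using m Max_in[OF assms(2)] by (auto simp: subset_iff)
  then have "pairing_rank (pair_mset (S, D)) < 0"
    using m by (simp add: pairing_rank_pair_mset[OF assms] strict_alt_def)
  ultimately show ?L by blast
qed

lemma num_negative_rank_eq:
  "int (num_negative_rank n) = (\<Sum>m = 1..n. weight_fps pair_weight (rank_pairs m) $ n)"
proof -
  let ?fib = "\<lambda>m. {t \<in> rank_pairs m. pair_weight t = n}"
  let ?M = "{P. partition_of n P \<and> simply_paired P \<and> pairing_rank P < 0}"
  have fin_pair: "finite S \<and> finite D" if "(S, D) \<in> (\<Union>m\<in>{1..n}. ?fib m)" for S D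
    using that rank_pairs_D by blast
  have inj: "inj_on pair_mset (\<Union>m\<in>{1..n}. ?fib m)"
  proof (rule inj_onI)
    fix s t
    assume s: "s \<in> (\<Union>m\<in>{1..n}. ?fib m)" and t: "t \<in> (\<Union>m\<in>{1..n}. ?fib m)"
      and eq: "pair_mset s = pair_mset t"
    obtain S D S' D' where st: "s = (S, D)" "t = (S', D')"
      by (meson surj_pair)
    then have "finite S" "finite D" "finite S'" "finite D'"
      using s t fin_pair by blast+
    then show "s = t"
      using eq unfolding st by (metis pair_mset_inverse)
  qed
  have M_eq: "?M = pair_mset ` (\<Union>m\<in>{1..n}. ?fib m)"
  proof (rule set_eqI)
    fix P
    show "P \<in> ?M \<longleftrightarrow> P \<in> pair_mset ` (\<Union>m\<in>{1..n}. ?fib m)"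
    proof
      assume P: "P \<in> ?M"
      define S where "S = {k. odd (count P k)}"
      define D where "D = repeated_parts P"
      have "S \<subseteq> set_mset P" "D \<subseteq> set_mset P"
        by (auto simp: S_def D_def repeated_parts_def elim: oddE simp flip: count_greater_zero_iff)
      then have fin: "finite S" "finite D"
        using finite_subset by blast+
      have eq: "P = pair_mset (S, D)"
        using P pair_mset_odd_repeated by (simp add: S_def D_def)
      then have "(S, D) \<in> (\<Union>m\<in>{1..n}. ?fib m)"
        using P negative_rank_pair_mset_iff[OF fin, of n] by auto
      then show "P \<in> pair_mset ` (\<Union>m\<in>{1..n}. ?fib m)"
        using eq by blast
    next
      assume "P \<in> pair_mset ` (\<Union>m\<in>{1..n}. ?fib m)"
      then obtain S D where SD: "P = pair_mset (S, D)" "(S, D) \<in> (\<Union>m\<in>{1..n}. ?fib m)"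
        by auto
      then show "P \<in> ?M"
        using negative_rank_pair_mset_iff[of S D n] fin_pair[OF SD(2)] by auto
    qed
  qed
  have "num_negative_rank n = card (\<Union>m\<in>{1..n}. ?fib m)"
    unfolding num_negative_rank_def M_eq by (intro card_image inj)
  also have "\<dots> = (\<Sum>m = 1..n. card (?fib m))"
  proof (rule card_UN_disjoint)
    \<comment> \<open>Finiteness of the fibres is pulled back from the finitely many partitions of
      \<open>n\<close> along the injection \<open>pair_mset\<close>.\<close>
    have "?M \<subseteq> {P. partition_of n P}" by auto
    then have "finite ?M"
      using finite_partitions by (rule finite_subset)
    then have "finite (\<Union>m\<in>{1..n}. ?fib m)"
      unfolding M_eq by (rule finite_imageD[OF _ inj])
    then show "\<forall>m\<in>{1..n}. finite (?fib m)"
      by simp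
    show "\<forall>i\<in>{1..n}. \<forall>j\<in>{1..n}. i \<noteq> j \<longrightarrow> ?fib i \<inter> ?fib j = {}"
    proof (intro ballI impI)
      fix i j :: nat assume "i \<noteq> j"
      \<comment> \<open>The index of a fibre is recovered as the alternating sum of the first
        component.\<close>
      moreover have "i = j" if "t \<in> rank_pairs i" "t \<in> rank_pairs j" for t
        using that rank_pairs_D[of "fst t" "snd t" i] rank_pairs_D[of "fst t" "snd t" j] by simp
      ultimately show "?fib i \<inter> ?fib j = {}"
        by blast
    qed
  qed simp
  finally show ?thesis
    by (simp add: weight_fps_nth)
qed

section \<open>Overpartitions into odd parts by number of parts\<close>

definition odd_overs :: "nat \<Rightarrow> (nat multiset \<times> nat set) set" where
  "odd_overs m = {(P, U). size P = m \<and> (\<forall>k\<in>#P. odd k) \<and> U \<subseteq> set_mset P}"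

definition over_weight :: "nat multiset \<times> nat set \<Rightarrow> nat" where
  "over_weight = (\<lambda>(P, U). sum_mset P)"

lemma odd_overs_fibre:
  "{t \<in> odd_overs m. over_weight t = n}
    = {X. overpartition_of n X \<and> (\<forall>k\<in>#fst X. odd k) \<and> size (fst X) = m}"
proof -
  have zero: "0 \<notin># P" if "\<forall>k\<in>#P. odd k" for P :: "nat multiset"
    using that even_zero by blast
  have "X \<in> odd_overs m \<and> over_weight X = n
      \<longleftrightarrow> overpartition_of n X \<and> (\<forall>k\<in>#fst X. odd k) \<and> size (fst X) = m" for X
    unfolding odd_overs_def over_weight_def overpartition_of_def partition_of_def
      mem_Collect_eq case_prod_beta
    using zero[of "fst X"] by argo
  then show ?thesis
    by (rule Collect_cong)
qed

lemma finite_odd_overs_fibre: "finite {t \<in> odd_overs m. over_weight t = n}"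
  unfolding odd_overs_fibre by (rule finite_subset[OF _ finite_overpartitions[of n]]) auto

definition shift_over :: "nat multiset \<times> nat set \<Rightarrow> nat multiset \<times> nat set" where
  "shift_over = (\<lambda>(P, U). (image_mset ((+) 2) P, (+) 2 ` U))"

definition add_plain :: "nat multiset \<times> nat set \<Rightarrow> nat multiset \<times> nat set" where
  "add_plain = (\<lambda>(P, U). (add_mset 1 P, U))"

definition shift_add_overlined :: "nat multiset \<times> nat set \<Rightarrow> nat multiset \<times> nat set" where
  "shift_add_overlined = (\<lambda>(P, U). (add_mset 1 (image_mset ((+) 2) P), insert 1 ((+) 2 ` U)))"

lemma sum_mset_shift: "sum_mset (image_mset ((+) 2) P) = sum_mset P + 2 * size P"
  for P :: "nat multiset"
  by (induction P) auto

text \<open>An odd part other than 1 stays odd when lowered by 2, and it is at least 2, so the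
  truncated subtraction really inverts \<open>(+) 2\<close>.\<close>

lemma unshift_over:
  assumes "(P, U) \<in> odd_overs m" "1 \<notin># P"
  shows "(P, U) \<in> shift_over ` odd_overs m"
proof -
  let ?f = "\<lambda>k::nat. k - 2"
  have sub: "U \<subseteq> set_mset P" and size: "size P = m" and odd: "\<And>k. k \<in># P \<Longrightarrow> odd k"
    using assms(1) by (simp_all add: odd_overs_def)
  have ge: "2 \<le> k" if "k \<in># P" for k
  proof -
    have "k \<noteq> 0" "k \<noteq> 1"
      using odd[OF that] that assms(2) by (metis even_zero, metis)
    then show ?thesis by simp
  qed
  have inv: "2 + ?f k = k" if "k \<in># P" for k
    using ge[OF that] by simp
  have "image_mset ((+) 2) (image_mset ?f P) = image_mset (\<lambda>k. k) P"
    unfolding multiset.map_comp o_def by (rule image_mset_cong) (rule inv)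
  moreover have "(+) 2 ` ?f ` U = (\<lambda>k. k) ` U"
    unfolding image_image by (rule image_cong[OF refl]) (rule inv[OF subsetD[OF sub]])
  ultimately have "shift_over (image_mset ?f P, ?f ` U) = (P, U)"
    by (simp add: shift_over_def)
  moreover have "odd (?f k)" if "k \<in># P" for k
    using odd[OF that] ge[OF that] by simp
  then have "(image_mset ?f P, ?f ` U) \<in> odd_overs m"
    using size image_mono[OF sub, of ?f] by (simp add: odd_overs_def)
  ultimately show ?thesis
    by (metis image_eqI)
qed

text \<open>The cases: no part 1; some 1 that is not overlined; a single 1, overlined. In the first and
  last case the parts larger than 1 are lowered by 2.\<close>

lemma odd_overs_Suc:
  "odd_overs (Suc m) = (shift_over ` odd_overs (Suc m) \<union> add_plain ` odd_overs m)
    \<union> shift_add_overlined ` odd_overs m" (is "_ = ?R")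
proof
  have "shift_over t \<in> odd_overs k" if "t \<in> odd_overs k" for t k
    using that by (cases t) (simp add: odd_overs_def shift_over_def image_mono)
  moreover have "add_plain t \<in> odd_overs (Suc m)" if "t \<in> odd_overs m" for t
    using that by (cases t) (simp add: odd_overs_def add_plain_def subset_insertI2)
  moreover have "shift_add_overlined t \<in> odd_overs (Suc m)" if "t \<in> odd_overs m" for t
    using that
    by (cases t) (simp add: odd_overs_def shift_add_overlined_def image_mono subset_insertI2)
  ultimately show "?R \<subseteq> odd_overs (Suc m)"
    by blast
  show "odd_overs (Suc m) \<subseteq> ?R"
  proof (rule subsetI)
    fix t assume t: "t \<in> odd_overs (Suc m)"
    obtain P U where PU: "t = (P, U)" by fastforce
    have sub: "U \<subseteq> set_mset P" and odd: "\<And>k. k \<in># P \<Longrightarrow> odd k" and size: "size P = Suc m"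
      using t by (simp_all add: PU odd_overs_def)
    have rest: "(P - {#1#}, V) \<in> odd_overs m" if "1 \<in># P" "V \<subseteq> set_mset (P - {#1#})" for V
    proof -
      have "\<forall>k\<in>#P - {#1#}. odd k"
        using odd in_diffD by metis
      then show ?thesis
        using that by (simp add: odd_overs_def size size_Diff_singleton)
    qed
    have others: "U - {1} \<subseteq> set_mset (P - {#1#})"
    proof
      fix k assume "k \<in> U - {1}"
      then have "k \<in># P" "k \<noteq> 1"
        using sub by auto
      then show "k \<in># P - {#1#}"
        by (simp add: in_diff_count)
    qed
    \<comment> \<open>When a 1 is deleted, \<open>U\<close> remains a legitimate set of overlined
      parts unless 1 is overlined and occurs only once; that exception is the third case.\<close>
    consider "1 \<notin># P" | "1 \<in># P" "U \<subseteq> set_mset (P - {#1#})"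
      | "1 \<in># P" "1 \<in> U" "1 \<notin># P - {#1#}"
      using others by blast
    then show "t \<in> ?R"
    proof cases
      case 1
      then show ?thesis using unshift_over t PU by blast
    next
      case 2
      have "t = add_plain (P - {#1#}, U)"
        using 2(1) by (simp add: PU add_plain_def)
      then show ?thesis using rest[OF 2] by blast
    next
      case 3
      have "(P - {#1#}, U - {1}) \<in> odd_overs m"
        using rest[OF 3(1) others] .
      then have "(P - {#1#}, U - {1}) \<in> shift_over ` odd_overs m"
        using 3 by (intro unshift_over)
      then obtain Q V where QV: "(Q, V) \<in> odd_overs m" "P - {#1#} = image_mset ((+) 2) Q"
        "U - {1} = (+) 2 ` V"
        by (auto simp: shift_over_def)
      have "U = insert 1 ((+) 2 ` V)"
        using QV(3) 3(2) by auto
      moreover have "P = add_mset 1 (image_mset ((+) 2) Q)"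
        unfolding QV(2)[symmetric] using 3(1) by simp
      ultimately have "t = shift_add_overlined (Q, V)"
        using PU by (simp add: shift_add_overlined_def)
      then show ?thesis using QV(1) by blast
    qed
  qed
qed

lemma inj_shift_over: "inj shift_over"
proof (rule injI)
  fix s t assume "shift_over s = shift_over t"
  moreover have "inj ((+) (2::nat))" "inj (image_mset ((+) (2::nat)))"
    by (simp_all add: multiset.inj_map)
  ultimately show "s = t"
    unfolding shift_over_def case_prod_beta prod.inject
    by (simp only: inj_image_eq_iff inj_eq prod_eq_iff)
qed

lemma inj_shift_add_overlined: "inj shift_add_overlined"
proof (rule injI)
  fix s t assume eq: "shift_add_overlined s = shift_add_overlined t"
  obtain P U Q V where st: "s = (P, U)" "t = (Q, V)"
    by (meson surj_pair)
  \<comment> \<open>Shifted parts are at least 2, so the inserted 1 can be cancelled from the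
    overlined sets.\<close>
  have "1 \<notin> (+) 2 ` W" for W :: "nat set"
    by auto
  then have "shift_over s = shift_over t"
    using eq st by (auto simp: shift_add_overlined_def shift_over_def insert_ident)
  then show "s = t"
    using inj_shift_over by (simp add: inj_eq)
qed

lemma weight_fps_odd_overs_0: "weight_fps over_weight (odd_overs 0) = 1"
proof -
  have "odd_overs 0 = {({#}, {})}"
    by (auto simp: odd_overs_def)
  then show ?thesis
    by (simp add: over_weight_def)
qed

text \<open>The three maps of \<open>odd_overs_Suc\<close> raise the weight by
  \<open>2 * Suc m\<close>, \<open>1\<close> and \<open>2 * m + 1\<close>. The first acts on the
  class itself and yields the factor on the left.\<close>

lemma weight_fps_odd_overs_Suc:
  "(1 - fps_X ^ (2 * Suc m)) * weight_fps over_weight (odd_overs (Suc m))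
    = fps_X * (1 + fps_X ^ (2 * m)) * weight_fps over_weight (odd_overs m)"
proof -
  let ?A = "shift_over ` odd_overs (Suc m)"
  let ?B = "add_plain ` odd_overs m"
  let ?C = "shift_add_overlined ` odd_overs m"
  let ?W = "weight_fps over_weight"
  have fin: "finite {t \<in> T. over_weight t = n}" if "T \<subseteq> odd_overs (Suc m)" for T n
    by (rule finite_subset[OF _ finite_odd_overs_fibre[of "Suc m" n]]) (use that in auto)
  have sub: "?A \<union> ?B \<subseteq> odd_overs (Suc m)" "?C \<subseteq> odd_overs (Suc m)"
    using odd_overs_Suc[of m] by blast+
  have no1: "1 \<notin># fst (shift_over t)" for t
    by (auto simp: shift_over_def case_prod_beta)
  have is1: "1 \<in># fst (add_plain t)" "1 \<in># fst (shift_add_overlined t)" for t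
    by (simp_all add: add_plain_def shift_add_overlined_def case_prod_beta)
  \<comment> \<open>Equality would make 1 an overlined part of \<open>t\<close>, hence a part of
    \<open>t\<close>; but the parts of \<open>t\<close> would be shifted ones.\<close>
  have plain: "add_plain t \<noteq> shift_add_overlined t'" if t: "t \<in> odd_overs m" for t t'
  proof
    assume eq: "add_plain t = shift_add_overlined t'"
    then have "1 \<in> snd t" and "fst t = fst (shift_over t')"
      by (simp_all add: add_plain_def shift_add_overlined_def shift_over_def case_prod_beta)
    then show False
      using t no1[of t'] by (auto simp: odd_overs_def)
  qed
  have shift: "shift_over t \<noteq> add_plain t'" "shift_over t \<noteq> shift_add_overlined t'" for t t'
    using no1[of t] is1[of t'] by metis+
  have disj: "?A \<inter> ?B = {}" "(?A \<union> ?B) \<inter> ?C = {}"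
    using shift(1) by blast (use shift(2) plain in blast)
  have "?W (odd_overs (Suc m)) = ?W (?A \<union> ?B) + ?W ?C"
    by (subst odd_overs_Suc, rule weight_fps_Un[OF fin[OF sub(1)] fin[OF sub(2)] disj(2)])
  also have "?W (?A \<union> ?B) = ?W ?A + ?W ?B"
    using sub by (intro weight_fps_Un fin disj) auto
  also have "?W ?A = fps_X ^ (2 * Suc m) * ?W (odd_overs (Suc m))"
    by (rule weight_fps_image[OF inj_on_subset[OF inj_shift_over]])
      (auto simp: odd_overs_def over_weight_def shift_over_def sum_mset_shift)
  also have "?W ?B = fps_X ^ 1 * ?W (odd_overs m)"
    by (rule weight_fps_image) (auto simp: inj_on_def over_weight_def add_plain_def)
  also have "?W ?C = fps_X ^ Suc (2 * m) * ?W (odd_overs m)"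
    by (rule weight_fps_image[OF inj_on_subset[OF inj_shift_add_overlined]])
      (auto simp: odd_overs_def over_weight_def shift_add_overlined_def sum_mset_shift)
  finally have "?W (odd_overs (Suc m)) = fps_X ^ (2 * Suc m) * ?W (odd_overs (Suc m))
      + (fps_X ^ 1 * ?W (odd_overs m) + fps_X ^ Suc (2 * m) * ?W (odd_overs m))"
    unfolding add.assoc .
  then have "(1 - fps_X ^ (2 * Suc m)) * ?W (odd_overs (Suc m))
      = fps_X ^ 1 * ?W (odd_overs m) + fps_X ^ Suc (2 * m) * ?W (odd_overs m)"
    by (rule one_minus_mult_eqI)
  then show ?thesis
    by (simp only: power_one_right power_Suc distrib_left distrib_right mult.assoc mult_1_right mult_1)
qed

lemma num_odd_overpartitions_eq:
  "int (num_odd_overpartitions n) = (\<Sum>m = 0..n. weight_fps over_weight (odd_overs m) $ n)"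
proof -
  let ?T = "{X. overpartition_of n X \<and> (\<forall>k\<in>#fst X. odd k)}"
  have fin: "finite ?T"
    by (rule finite_subset[OF _ finite_overpartitions[of n]]) auto
  \<comment> \<open>The parts are positive, so there are at most \<open>n\<close> of them.\<close>
  have range: "(\<lambda>X. size (fst X)) ` ?T \<subseteq> {0..n}"
  proof (rule image_subsetI)
    fix X assume "X \<in> ?T"
    then show "size (fst X) \<in> {0..n}"
      using size_le_sum_mset[of "fst X"] by (simp add: overpartition_of_def partition_of_def)
  qed
  have "card ?T = (\<Sum>m = 0..n. card {X \<in> ?T. size (fst X) = m})"
    using sum.group[OF fin _ range, of "\<lambda>_. 1::nat", symmetric]
    by (simp only: card_eq_sum finite_atLeastAtMost)
  also have "\<dots> = (\<Sum>m = 0..n. card {t \<in> odd_overs m. over_weight t = n})"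
    unfolding odd_overs_fibre mem_Collect_eq conj_assoc ..
  finally show ?thesis
    by (simp add: weight_fps_nth num_odd_overpartitions_def)
qed

section \<open>Comparison of the two recurrences\<close>

lemma one_minus_fps_X_power_neq_0: "k > 0 \<Longrightarrow> (1 - fps_X ^ k :: int fps) \<noteq> 0"
proof -
  assume "k > 0"
  then have "(1 - fps_X ^ k :: int fps) $ 0 \<noteq> 0"
    by (simp add: fps_X_power_nth)
  then show ?thesis
    by (metis fps_zero_nth)
qed

text \<open>From 1 on both families obey the same first-order recurrence, whose left factor is
  nonzero and can be cancelled over the integers. At \<open>m = 1\<close> the two products are
  \<open>2 * fps_X\<close> and \<open>fps_X\<close>.\<close>

lemma weight_fps_odd_overs_eq:
  "m \<ge> 1 \<Longrightarrow> weight_fps over_weight (odd_overs m) = 2 * weight_fps pair_weight (rank_pairs m)"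
proof (induction m rule: dec_induct)
  case base
  have "(1 - fps_X ^ (2 * Suc 0)) * weight_fps over_weight (odd_overs (Suc 0)) = 2 * fps_X"
    unfolding weight_fps_odd_overs_Suc weight_fps_odd_overs_0 by simp
  also have "\<dots> = 2 * ((1 - fps_X ^ 2) * weight_fps pair_weight (rank_pairs 1))"
    by (simp only: weight_fps_rank_pairs_1)
  also have "\<dots> = (1 - fps_X ^ (2 * Suc 0)) * (2 * weight_fps pair_weight (rank_pairs (Suc 0)))"
    unfolding One_nat_def[symmetric] mult_1_right by (rule mult.left_commute)
  finally show ?case
    unfolding One_nat_def
    by (rule mult_left_cancel[OF one_minus_fps_X_power_neq_0, THEN iffD1, rotated]) simp
next
  case (step m)
  have "(1 - fps_X ^ (2 * Suc m)) * weight_fps over_weight (odd_overs (Suc m))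
      = 2 * (fps_X * (1 + fps_X ^ (2 * m)) * weight_fps pair_weight (rank_pairs m))"
    unfolding weight_fps_odd_overs_Suc step.IH by (rule mult.left_commute)
  also have "\<dots> = (1 - fps_X ^ (2 * Suc m)) * (2 * weight_fps pair_weight (rank_pairs (Suc m)))"
    unfolding weight_fps_rank_pairs_Suc[OF step.hyps(1), symmetric] by (rule mult.left_commute)
  finally show ?case
    by (rule mult_left_cancel[OF one_minus_fps_X_power_neq_0, THEN iffD1, rotated]) simp
qed

theorem theorem6p3:
  fixes n :: nat
  assumes "n \<ge> 1"
  shows "real (num_negative_rank n) = 1 / 2 * real (num_odd_overpartitions n)"
proof -
  \<comment> \<open>The term \<open>m = 0\<close> is the series 1, counting the empty overpartition;
    its coefficient at \<open>n \<ge> 1\<close> is 0.\<close>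
  have "int (num_odd_overpartitions n)
      = (\<Sum>m = 1..n. weight_fps over_weight (odd_overs m) $ n)"
    unfolding num_odd_overpartitions_eq sum.atLeast_Suc_atMost[OF le0] weight_fps_odd_overs_0
    using assms by simp
  also have "\<dots> = (\<Sum>m = 1..n. 2 * weight_fps pair_weight (rank_pairs m) $ n)"
  proof (rule sum.cong[OF refl])
    fix m assume "m \<in> {1..n}"
    then have "weight_fps over_weight (odd_overs m) = 2 * weight_fps pair_weight (rank_pairs m)"
      by (intro weight_fps_odd_overs_eq) simp
    then show "weight_fps over_weight (odd_overs m) $ n
        = 2 * weight_fps pair_weight (rank_pairs m) $ n"
      by (simp only: mult_2 fps_add_nth)
  qed
  also have "\<dots> = 2 * int (num_negative_rank n)"
    by (simp only: num_negative_rank_eq sum_distrib_left)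
  finally have "num_odd_overpartitions n = 2 * num_negative_rank n"
    by linarith
  then show ?thesis by simp
qed

end
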